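(* Let $(X_1,Y_1),\dots,(X_n,Y_n)$ be observations with $X_i\in\mathbb R^d$, $Y_i\in\mathbb R$, and let $h_n(\Psi,\alpha)=\sum_{i=1}^n\{Y_i-\Psi(\alpha^TX_i)\}^2$. Then the infimum of $(\Psi,\alpha)\mapsto h_n(\Psi,\alpha)$ over $\mathcal M\times\mathcal S_{d-1}$ is achieved. Moreover, if $(\hat\Psi_n,\hat\alpha_n)$ satisfies the following conditions, then it is a minimizer: (i) $\hat\alpha_n\in\mathcal S^X$ linearly induces a permutation $\hat\pi_n$ that minimizes $\pi\mapsto\tilde h_n(\pi):=\sum_{k=1}^m\tilde n_{\pi(k)}(\tilde y_{\pi(k)}-d_k^\pi)^2$ over $\mathcal P^X$; and (ii) $\hat\Psi_n$ is monotone non-decreasing with $\hat\Psi_n(\hat\alpha_n^Tx_{\hat\pi_n(k)})=d_k^{\hat\pi_n}$ for all $k=1,\dots,m$.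
   Context: $\mathcal S_{d-1}$ is the Euclidean unit sphere of $\mathbb R^d$; $\mathcal M$ is the class of all non-decreasing functions on $\mathbb R$; $\mathcal S^X$ is the set of all $\alpha\in\mathcal S_{d-1}$ such that $\alpha^TX_i\ne\alpha^TX_j$ for all $i\ne j$ with $X_i\neq X_j$. Let $x_1,\dots,x_m$ be the distinct values of $X_1,\dots,X_n$, and for $k=1,\dots,m$ let $\tilde n_k=\sum_{i=1}^n\mathbb I_{X_i=x_k}$ and $\tilde y_k=\tilde n_k^{-1}\sum_{i=1}^nY_i\mathbb I_{X_i=x_k}$. A vector $\alpha\in\mathcal S_{d-1}$ linearly induces the permutation $\pi$ of $\{1,\dots,m\}$ if $\alpha^Tx_{\pi(1)}<\dots<\alpha^Tx_{\pi(m)}$. $\mathcal P^X$ is the set of all permutations of $\{1,\dots,m\}$ linearly induced by some $\alpha\in\mathcal S_{d-1}$. (Each $\alpha\in\mathcal S^X$ linearly induces a unique permutation.) For $\pi\in\mathcal P^X$, $d_1^\pi\le\dots\le d_m^\pi$ denote the left derivatives, at the successive abscissae $\sum_{j=1}^k\tilde n_{\pi(j)}$, $k=1,\dots,m$, of the greatest convex minorant of the cumulative sum diagram consisting of the points $(0,0)$ and $\left(\sum_{j=1}^k\tilde n_{\pi(j)},\sum_{j=1}^k\tilde n_{\pi(j)}\tilde y_{\pi(j)}\right)$, $k=1,\dots,m$. The result is deterministic, holding for every realization of the sample. *)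

theory Defs
  imports "HOL-Analysis.Analysis"
begin

definition least_squares_crit ::
    "nat \<Rightarrow> (nat \<Rightarrow> real ^ 'd) \<Rightarrow> (nat \<Rightarrow> real) \<Rightarrow> (real \<Rightarrow> real) \<Rightarrow> real ^ 'd \<Rightarrow> real" where
  "least_squares_crit n X Y \<Psi> \<alpha> = (\<Sum>i=1..n. (Y i - \<Psi> (\<alpha> \<bullet> X i))\<^sup>2)"

definition separating_directions :: "nat \<Rightarrow> (nat \<Rightarrow> real ^ 'd) \<Rightarrow> (real ^ 'd) set" where
  "separating_directions n X =
    {\<alpha> \<in> sphere 0 1. \<forall>i\<in>{1..n}. \<forall>j\<in>{1..n}. i \<noteq> j \<and> X i \<noteq> X j \<longrightarrow> \<alpha> \<bullet> X i \<noteq> \<alpha> \<bullet> X j}"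

definition value_weight :: "nat \<Rightarrow> (nat \<Rightarrow> real ^ 'd) \<Rightarrow> real ^ 'd \<Rightarrow> real" where
  "value_weight n X v = (\<Sum>i=1..n. of_bool (X i = v))"

definition value_mean ::
    "nat \<Rightarrow> (nat \<Rightarrow> real ^ 'd) \<Rightarrow> (nat \<Rightarrow> real) \<Rightarrow> real ^ 'd \<Rightarrow> real" where
  "value_mean n X Y v = (\<Sum>i=1..n. Y i * of_bool (X i = v)) / value_weight n X v"

text \<open>In the following, \<open>x\<close> enumerates the distinct values as \<open>x 1, \<dots>, x m\<close>.\<close>

definition linearly_induces ::
    "nat \<Rightarrow> (nat \<Rightarrow> real ^ 'd) \<Rightarrow> real ^ 'd \<Rightarrow> (nat \<Rightarrow> nat) \<Rightarrow> bool" where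
  "linearly_induces m x \<alpha> \<pi> \<longleftrightarrow>
    \<alpha> \<in> sphere 0 1 \<and> \<pi> permutes {1..m} \<and> strict_mono_on {1..m} (\<lambda>k. \<alpha> \<bullet> x (\<pi> k))"

definition induced_permutations :: "nat \<Rightarrow> (nat \<Rightarrow> real ^ 'd) \<Rightarrow> (nat \<Rightarrow> nat) set" where
  "induced_permutations m x = {\<pi>. \<exists>\<alpha>. linearly_induces m x \<alpha> \<pi>}"

text \<open>
  The greatest convex minorant of a finite set of points in the plane is the pointwise supremum of
  all convex functions, on the interval spanned by the abscissae, whose graph lies on or below all
  the points. It is only meaningful on that interval: elsewhere the supremum is that of a set which
  is unbounded above.
\<close>

definition greatest_convex_minorant :: "(real \<times> real) set \<Rightarrow> real \<Rightarrow> real" where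
  "greatest_convex_minorant P t =
    (SUP f \<in> {f. convex_on (convex hull (fst ` P)) f \<and> (\<forall>(a, b)\<in>P. f a \<le> b)}. f t)"

definition left_derivative :: "(real \<Rightarrow> real) \<Rightarrow> real \<Rightarrow> real" where
  "left_derivative f t = (THE D. (f has_real_derivative D) (at_left t))"

definition cum_weight ::
    "nat \<Rightarrow> (nat \<Rightarrow> real ^ 'd) \<Rightarrow> (nat \<Rightarrow> real ^ 'd) \<Rightarrow> (nat \<Rightarrow> nat) \<Rightarrow> nat \<Rightarrow> real" where
  "cum_weight n X x \<pi> k = (\<Sum>j=1..k. value_weight n X (x (\<pi> j)))"

definition cum_sum ::
    "nat \<Rightarrow> (nat \<Rightarrow> real ^ 'd) \<Rightarrow> (nat \<Rightarrow> real) \<Rightarrow> (nat \<Rightarrow> real ^ 'd) \<Rightarrow> (nat \<Rightarrow> nat) \<Rightarrow> nat \<Rightarrow> real" where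
  "cum_sum n X Y x \<pi> k = (\<Sum>j=1..k. value_weight n X (x (\<pi> j)) * value_mean n X Y (x (\<pi> j)))"

definition cum_sum_diagram ::
    "nat \<Rightarrow> (nat \<Rightarrow> real ^ 'd) \<Rightarrow> (nat \<Rightarrow> real) \<Rightarrow> nat \<Rightarrow> (nat \<Rightarrow> real ^ 'd) \<Rightarrow> (nat \<Rightarrow> nat)
      \<Rightarrow> (real \<times> real) set" where
  "cum_sum_diagram n X Y m x \<pi> =
    insert (0, 0) ((\<lambda>k. (cum_weight n X x \<pi> k, cum_sum n X Y x \<pi> k)) ` {1..m})"

definition gcm_slope ::
    "nat \<Rightarrow> (nat \<Rightarrow> real ^ 'd) \<Rightarrow> (nat \<Rightarrow> real) \<Rightarrow> nat \<Rightarrow> (nat \<Rightarrow> real ^ 'd) \<Rightarrow> (nat \<Rightarrow> nat)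
      \<Rightarrow> nat \<Rightarrow> real" where
  "gcm_slope n X Y m x \<pi> k =
    left_derivative (greatest_convex_minorant (cum_sum_diagram n X Y m x \<pi>)) (cum_weight n X x \<pi> k)"

definition permutation_crit ::
    "nat \<Rightarrow> (nat \<Rightarrow> real ^ 'd) \<Rightarrow> (nat \<Rightarrow> real) \<Rightarrow> nat \<Rightarrow> (nat \<Rightarrow> real ^ 'd) \<Rightarrow> (nat \<Rightarrow> nat) \<Rightarrow> real" where
  "permutation_crit n X Y m x \<pi> =
    (\<Sum>k=1..m. value_weight n X (x (\<pi> k)) *
      (value_mean n X Y (x (\<pi> k)) - gcm_slope n X Y m x \<pi> k)\<^sup>2)"

definition is_minimizer ::
    "nat \<Rightarrow> (nat \<Rightarrow> real ^ 'd) \<Rightarrow> (nat \<Rightarrow> real) \<Rightarrow> (real \<Rightarrow> real) \<Rightarrow> real ^ 'd \<Rightarrow> bool" where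
  "is_minimizer n X Y \<Psi> \<alpha> \<longleftrightarrow>
    is_arg_min (\<lambda>(\<Psi>, \<alpha>). least_squares_crit n X Y \<Psi> \<alpha>)
      (\<lambda>(\<Psi>, \<alpha>). mono \<Psi> \<and> \<alpha> \<in> sphere 0 1) (\<Psi>, \<alpha>)"

end

theory Submission
  imports Defs
begin

text \<open>
  For a fixed direction \<open>\<alpha>\<close> the criterion depends on \<open>\<Psi>\<close> only through its values at the numbers
  \<open>\<alpha> \<bullet> x k\<close>. Expanding the squares around the mean response of each group of observations
  with the same covariate splits the criterion into a within-group term, which depends neither on
  \<open>\<Psi>\<close> nor on \<open>\<alpha>\<close>, and a weighted sum of squares over the distinct covariates
  (lemma \<open>least_squares_crit_decompose\<close>). Only the second term has to be minimized, and what is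
  required of the values of \<open>\<Psi>\<close> is that they are monotone in the order given by \<open>\<alpha>\<close>.

  If \<open>\<alpha>\<close> separates the covariates, this order is an induced permutation, and the problem is a
  weighted isotonic regression. Its solution consists of the slopes of the greatest convex minorant
  of the cumulative sum diagram (lemmas \<open>slope_least_squares\<close> and \<open>permutation_crit_le\<close>). If
  \<open>\<alpha>\<close> has ties, a small perturbation breaks them without reversing any strict
  inequality, so the values of \<open>\<Psi>\<close> are still monotone along some induced permutation
  (lemma \<open>ex_refining_permutation\<close>). Tied covariates only restrict \<open>\<Psi>\<close> further, so in
  every case the criterion is bounded below by the within-group term plus the criterion of an
  induced permutation.

  There are finitely many induced permutations, so one of them is optimal. A monotone function that
  takes the slopes of the minorant as its values attains the bound, and such a function
  exists because the slopes are non-decreasing.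

  The minorant itself is never constructed globally. Over each gap between successive abscissae it
  is identified with a chord of the diagram that supports the whole diagram from below
  (lemma \<open>ex_support_chord\<close>); all properties of its slopes follow from these chords.
\<close>

section \<open>Slopes of the greatest convex minorant of a finite diagram\<close>

locale planar_diagram =
  fixes m :: nat and W S :: "nat \<Rightarrow> real"
  assumes W_strict_mono: "strict_mono_on {..m} W"
begin

definition diagram :: "(real \<times> real) set" where
  "diagram = (\<lambda>k. (W k, S k)) ` {..m}"

abbreviation gcm :: "real \<Rightarrow> real" where
  "gcm \<equiv> greatest_convex_minorant diagram"

abbreviation slope :: "nat \<Rightarrow> real" where
  "slope k \<equiv> left_derivative gcm (W k)"

lemma W_less: "i < j \<Longrightarrow> j \<le> m \<Longrightarrow> W i < W j"
  using W_strict_mono by (auto simp: strict_mono_on_def)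

lemma W_le: "i \<le> j \<Longrightarrow> j \<le> m \<Longrightarrow> W i \<le> W j"
  using W_less[of i j] by (cases "i = j") auto

text \<open>
  A chord whose line bounds the diagram from below. Its endpoints are kept as indices because they
  are the places where the minorant is known to touch the diagram.
\<close>

definition support_chord :: "real \<Rightarrow> real \<Rightarrow> nat \<Rightarrow> nat \<Rightarrow> bool" where
  "support_chord c D a b \<longleftrightarrow> a < b \<and> b \<le> m \<and> S a = c + D * W a \<and> S b = c + D * W b \<and>
     (\<forall>j\<le>m. c + D * W j \<le> S j)"

text \<open>
  Among the finitely many chords that cross the gap to the left of \<open>W k\<close>, the one that is lowest
  above the midpoint of the gap supports the diagram: a point below it could replace
  the endpoint on its own side of the gap and would give a chord that is lower still.
\<close>

lemma ex_support_chord: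
  assumes "1 \<le> k" "k \<le> m"
  shows "\<exists>c D a b. a < k \<and> k \<le> b \<and> support_chord c D a b"
proof -
  define t where "t = (W (k - 1) + W k) / 2"
  have tl: "W (k - 1) < t" and tr: "t < W k"
    using W_less[of "k - 1" k] assms by (auto simp: t_def)
  have lt: "W i < t" if "i < k" for i
    using W_le[of i "k - 1"] that assms tl by linarith
  have gt: "t < W j" if "k \<le> j" "j \<le> m" for j
    using W_le[of k j] that tr by auto
  define q where "q i j = (S j - S i) / (W j - W i)" for i j
  define height where "height p = (case p of (i, j) \<Rightarrow> S i + q i j * (t - W i))" for p
  define Q where "Q = {..<k} \<times> {k..m}"
  have "finite Q" "Q \<noteq> {}" using assms by (auto simp: Q_def lessThan_empty_iff)
  then obtain p where p: "p \<in> Q" "\<And>p'. p' \<in> Q \<Longrightarrow> height p \<le> height p'"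
    using arg_min_if_finite[of Q height] by (metis not_le)
  obtain a b where ab: "p = (a, b)" by fastforce
  have a: "a < k" and b: "k \<le> b" "b \<le> m" using p(1) by (auto simp: ab Q_def)
  define D where "D = q a b"
  define c where "c = S a - D * W a"
  have Wab: "W a < W b" using W_less[of a b] a b by auto
  have Sa: "S a = c + D * W a" by (simp add: c_def)
  have Sb: "S b = c + D * W b"
  proof -
    have "D * (W b - W a) = S b - S a" using Wab by (simp add: D_def q_def)
    then show ?thesis by (simp add: c_def algebra_simps)
  qed
  have height_ab: "height (a, b) = c + D * t"
    by (simp add: height_def c_def D_def algebra_simps)
  have height_right: "height (i, j) = S j - q i j * (W j - t)" if "W i < W j" for i j
    using that by (simp add: height_def q_def field_simps)
  have "c + D * W j \<le> S j" if j: "j \<le> m" for j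
  proof (rule ccontr)
    assume "\<not> ?thesis"
    then have below: "S j < c + D * W j" by simp
    show False
    proof (cases "j < k")
      case True
      have Wjb: "W j < W b" using lt[OF True] gt[OF b] by simp
      have "D * (W b - W j) < S b - S j" using below Sb by (simp add: algebra_simps)
      then have "D < q j b" using Wjb by (simp add: q_def pos_less_divide_eq)
      then have "D * (W b - t) < q j b * (W b - t)" using gt[OF b] by simp
      then have "height (j, b) < height (a, b)"
        unfolding height_ab height_right[OF Wjb] using Sb by (simp add: algebra_simps)
      moreover have "(j, b) \<in> Q" using True b by (auto simp: Q_def)
      ultimately show False using p(2)[of "(j, b)"] ab by simp
    next
      case False
      then have kj: "k \<le> j" by simp
      have Waj: "W a < W j" using lt[OF a] gt[OF kj j] by simp
      have "S j - S a < D * (W j - W a)" using below Sa by (simp add: algebra_simps)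
      then have "q a j < D" using Waj by (simp add: q_def pos_divide_less_eq)
      then have "q a j * (t - W a) < D * (t - W a)" using lt[OF a] by simp
      then have "height (a, j) < height (a, b)"
        unfolding height_ab using Sa by (simp add: height_def algebra_simps)
      moreover have "(a, j) \<in> Q" using a kj j by (auto simp: Q_def)
      ultimately show False using p(2)[of "(a, j)"] ab by simp
    qed
  qed
  then have "support_chord c D a b" using a b Sa Sb by (simp add: support_chord_def)
  then show ?thesis using a b by blast
qed

text \<open>
  The line of a supporting chord is an admissible convex function, so the minorant is at least
  that line. Between the endpoints it is also an upper bound, because a convex function
  below the diagram lies below the chord joining two points of the diagram.
\<close>

lemma gcm_eq_support_chord:
  assumes "support_chord c D a b" "W a \<le> t" "t \<le> W b"
  shows "gcm t = c + D * t"
proof -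
  define F where "F = {f. convex_on (convex hull (fst ` diagram)) f \<and> (\<forall>(u, v)\<in>diagram. f u \<le> v)}"
  have ab: "a < b" "b \<le> m" and Sa: "S a = c + D * W a" and Sb: "S b = c + D * W b"
    and below: "\<And>j. j \<le> m \<Longrightarrow> c + D * W j \<le> S j"
    using assms(1) by (auto simp: support_chord_def)
  have "(\<lambda>u. c + D * u) \<in> F"
  proof -
    have "convex_on T (\<lambda>u. c + D * u)" if "convex T" for T
    proof (rule convex_onI[OF _ that])
      fix u p q :: real
      show "c + D * ((1 - u) *\<^sub>R p + u *\<^sub>R q) \<le> (1 - u) * (c + D * p) + u * (c + D * q)"
        by (simp add: algebra_simps)
    qed
    then show ?thesis by (auto simp: F_def diagram_def below)
  qed
  moreover have "f t \<le> c + D * t" if "f \<in> F" for f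
  proof -
    have f: "convex_on (convex hull (fst ` diagram)) f" "\<And>j. j \<le> m \<Longrightarrow> f (W j) \<le> S j"
      using that by (auto simp: F_def diagram_def)
    have hull: "W j \<in> convex hull (fst ` diagram)" if "j \<le> m" for j
      using that by (intro hull_inc) (force simp: diagram_def)
    have "t \<in> closed_segment (W a) (W b)"
      using assms(2,3) by (simp add: closed_segment_eq_real_ivl)
    then obtain u where u: "0 \<le> u" "u \<le> 1" "t = (1 - u) * W a + u * W b"
      by (auto simp: closed_segment_def)
    have "f t \<le> (1 - u) * f (W a) + u * f (W b)"
      using convex_onD[OF f(1), of u "W a" "W b"] u hull ab by auto
    also have "\<dots> \<le> (1 - u) * S a + u * S b"
      using f(2)[of a] f(2)[of b] ab u by (intro add_mono mult_left_mono) auto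
    also have "\<dots> = c + D * t"
      unfolding u(3) Sa Sb by (simp add: algebra_simps)
    finally show ?thesis .
  qed
  ultimately show ?thesis
    unfolding greatest_convex_minorant_def F_def[symmetric]
    by (intro cSup_eq_maximum) auto
qed

lemma slope_eq_support_chord:
  assumes "support_chord c D a b" "a < k" "k \<le> b"
  shows "slope k = D"
proof -
  have Wak: "W a < W k" and Wkb: "W k \<le> W b"
    using assms W_less[of a k] W_le[of k b] by (auto simp: support_chord_def)
  have "((\<lambda>t. c + D * t) has_real_derivative D) (at_left (W k))"
    by (auto intro!: derivative_eq_intros)
  moreover have "\<forall>\<^sub>F t in at_left (W k). c + D * t = gcm t"
    using eventually_at_left_real[OF Wak]
    by eventually_elim (use gcm_eq_support_chord[OF assms(1)] Wkb in auto)
  moreover have "c + D * W k = gcm (W k)"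
    using gcm_eq_support_chord[OF assms(1), of "W k"] Wak Wkb by auto
  ultimately have D: "(gcm has_real_derivative D) (at_left (W k))"
    by (subst (asm) has_field_derivative_cong_eventually)
  have "D' = D" if "(gcm has_real_derivative D') (at_left (W k))" for D'
    using that D unfolding has_field_derivative_iff
    by (rule tendsto_unique[OF trivial_limit_at_left_real])
  with D show ?thesis
    unfolding left_derivative_def by (rule the_equality)
qed

lemma ex_slope_chord:
  assumes "1 \<le> k" "k \<le> m"
  obtains c a b where "a < k" "k \<le> b" "support_chord c (slope k) a b"
  using ex_support_chord[OF assms] slope_eq_support_chord by metis

lemma gcm_increment:
  assumes "1 \<le> k" "k \<le> m"
  shows "gcm (W k) - gcm (W (k - 1)) = slope k * (W k - W (k - 1))"
proof -
  obtain c a b where ab: "a < k" "k \<le> b" and C: "support_chord c (slope k) a b"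
    using ex_slope_chord[OF assms] .
  have "b \<le> m" using C by (simp add: support_chord_def)
  then have "W a \<le> W (k - 1)" "W (k - 1) \<le> W k" "W k \<le> W b"
    using ab by (auto intro!: W_le)
  then show ?thesis
    by (simp add: gcm_eq_support_chord[OF C] algebra_simps)
qed

text \<open>
  Each of two supporting lines lies below the points that the other one passes through. Comparing
  them at the left end of the left chord and at the right end of the right chord orders the slopes.
\<close>

lemma slope_mono:
  assumes "1 \<le> k" "k \<le> l" "l \<le> m"
  shows "slope k \<le> slope l"
proof -
  obtain c a b where ab: "a < k" and C: "support_chord c (slope k) a b"
    using ex_slope_chord[OF assms(1) le_trans[OF assms(2,3)]] .
  obtain c' a' b' where ab': "l \<le> b'" and C': "support_chord c' (slope l) a' b'"
    using ex_slope_chord[OF le_trans[OF assms(1,2)] assms(3)] .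
  have b': "b' \<le> m" and a: "a \<le> m"
    using C' ab assms by (auto simp: support_chord_def)
  have "c' + slope l * W a \<le> c + slope k * W a" "c + slope k * W b' \<le> c' + slope l * W b'"
    using C C' a b' unfolding support_chord_def by metis+
  then have "slope k * (W b' - W a) \<le> slope l * (W b' - W a)"
    by (simp add: algebra_simps)
  moreover have "W a < W b'" using W_less[of a b'] ab ab' b' assms by auto
  ultimately show ?thesis by simp
qed

lemma gcm_le:
  assumes "1 \<le> k" "k \<le> m"
  shows "gcm (W k) \<le> S k"
proof -
  obtain c a b where ab: "a < k" "k \<le> b" and C: "support_chord c (slope k) a b"
    using ex_slope_chord[OF assms] .
  have "W a \<le> W k" "W k \<le> W b"
    using ab C by (auto intro!: W_le simp: support_chord_def)
  then show ?thesis
    using C assms by (simp add: gcm_eq_support_chord[OF C] support_chord_def)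
qed

lemma gcm_first:
  assumes "1 \<le> m"
  shows "gcm (W 0) = S 0"
proof -
  obtain c a b where ab: "a < 1" "1 \<le> b" and C: "support_chord c (slope 1) a b"
    using ex_slope_chord[OF order_refl assms] .
  have "W 0 \<le> W b" using C by (auto intro!: W_le simp: support_chord_def)
  then show ?thesis
    using C ab gcm_eq_support_chord[OF C, of "W 0"] by (simp add: support_chord_def)
qed

text \<open>
  This is the complementarity condition of isotonic regression: the minorant can pass
  strictly below a point of the diagram only in the interior of a supporting chord, where its slope
  does not change.
\<close>

lemma gcm_touches:
  assumes "1 \<le> k" "k \<le> m" "k < m \<Longrightarrow> slope k \<noteq> slope (Suc k)"
  shows "gcm (W k) = S k"
proof -
  obtain c a b where ab: "a < k" "k \<le> b" and C: "support_chord c (slope k) a b"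
    using ex_slope_chord[OF assms(1,2)] .
  have b: "b \<le> m" using C by (simp add: support_chord_def)
  have "b = k"
  proof (rule ccontr)
    assume "b \<noteq> k"
    then have "Suc k \<le> b" using ab by linarith
    then have "slope (Suc k) = slope k"
      using slope_eq_support_chord[OF C _ \<open>Suc k \<le> b\<close>] ab by linarith
    moreover have "k < m" using \<open>Suc k \<le> b\<close> b by linarith
    ultimately show False using assms(3) by metis
  qed
  have "W a \<le> W b" using ab b W_le by (meson le_trans less_imp_le)
  then have "gcm (W b) = c + slope k * W b" by (rule gcm_eq_support_chord[OF C _ order_refl])
  also have "\<dots> = S b" using C unfolding support_chord_def by metis
  finally show ?thesis unfolding \<open>b = k\<close> .
qed

end

section \<open>Weighted isotonic least squares\<close>

lemma sum_by_parts:
  fixes E v :: "nat \<Rightarrow> real"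
  assumes "E 0 = 0"
  shows "(\<Sum>k=1..m. (E k - E (k - 1)) * v k) =
    E m * v (Suc m) - (\<Sum>k=1..m. E k * (v (Suc k) - v k))"
  by (induction m) (auto simp: assms algebra_simps)

text \<open>
  Expanding around the slopes, the excess of the right-hand side is a sum of squares plus
  twice a cross term. With \<open>E = S - gcm\<close> the gap between diagram and minorant, which
  vanishes at both ends, summation by parts turns the sum in the cross term into
  \<open>- (\<Sum>k. E k * (v (Suc k) - v k))\<close> for \<open>v = slope - z\<close>. Where \<open>E\<close> is
  positive the slope is locally constant, so \<open>v\<close> does not increase there.
\<close>

lemma (in planar_diagram) slope_least_squares:
  fixes w y z :: "nat \<Rightarrow> real"
  assumes w: "\<And>k. k \<in> {1..m} \<Longrightarrow> w k = W k - W (k - 1)"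
    and wy: "\<And>k. k \<in> {1..m} \<Longrightarrow> w k * y k = S k - S (k - 1)"
    and z: "mono_on {1..m} z"
  shows "(\<Sum>k=1..m. w k * (y k - slope k)\<^sup>2) \<le> (\<Sum>k=1..m. w k * (y k - z k)\<^sup>2)"
proof (cases "m = 0")
  case False
  define E where "E k = S k - gcm (W k)" for k
  define v where "v k = slope k - z k" for k
  have E0: "E 0 = 0" using gcm_first False by (simp add: E_def)
  have Em: "E m = 0" using gcm_touches[of m] False by (simp add: E_def)
  have "E k * (v (Suc k) - v k) \<le> 0" if k: "k \<in> {1..m}" for k
  proof (cases "E k = 0")
    case False
    then have "k < m" using k Em by (cases "k = m") auto
    then have "slope k = slope (Suc k)" and "z k \<le> z (Suc k)"
      using gcm_touches[of k] False k z by (auto simp: E_def mono_on_def)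
    moreover have "0 \<le> E k" using gcm_le[of k] k by (simp add: E_def)
    ultimately show ?thesis by (simp add: v_def mult_nonneg_nonpos)
  qed simp
  then have "(\<Sum>k=1..m. E k * (v (Suc k) - v k)) \<le> 0" by (rule sum_nonpos)
  then have "0 \<le> (\<Sum>k=1..m. (E k - E (k - 1)) * v k)"
    using sum_by_parts[of E v m] E0 Em by simp
  also have "\<dots> = (\<Sum>k=1..m. w k * (y k - slope k) * v k)"
  proof (intro sum.cong refl)
    fix k assume k: "k \<in> {1..m}"
    have "E k - E (k - 1) = w k * y k - slope k * w k"
      using gcm_increment[of k] w[OF k] wy[OF k] k by (simp add: E_def)
    then show "(E k - E (k - 1)) * v k = w k * (y k - slope k) * v k"
      by (simp add: right_diff_distrib mult.commute)
  qed
  finally have cross: "0 \<le> (\<Sum>k=1..m. w k * (y k - slope k) * v k)" .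
  have "0 \<le> (\<Sum>k=1..m. w k * (v k)\<^sup>2)"
    using w W_le by (intro sum_nonneg) auto
  moreover have "(\<Sum>k=1..m. w k * (y k - z k)\<^sup>2) =
    (\<Sum>k=1..m. w k * (y k - slope k)\<^sup>2) + 2 * (\<Sum>k=1..m. w k * (y k - slope k) * v k)
      + (\<Sum>k=1..m. w k * (v k)\<^sup>2)"
    unfolding sum_distrib_left sum.distrib[symmetric]
    by (intro sum.cong refl) (simp add: v_def power2_eq_square algebra_simps)
  ultimately show ?thesis using cross by linarith
qed simp

section \<open>Grouping the observations by the value of the covariate\<close>

lemma value_weight_pos:
  assumes "v \<in> X ` {1..n}"
  shows "0 < value_weight n X v"
proof -
  obtain i where i: "i \<in> {1..n}" "X i = v" using assms by auto
  then have "of_bool (X i = v) \<le> value_weight n X v"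
    unfolding value_weight_def by (intro member_le_sum) auto
  then show ?thesis using i by simp
qed

lemma bij_betw_permuted:
  assumes "bij_betw x {1..m} A" "\<pi> permutes {1..m}"
  shows "bij_betw (\<lambda>k. x (\<pi> k)) {1..m} A"
  using bij_betw_trans[OF permutes_imp_bij[OF assms(2)] assms(1)] by (simp add: comp_def)

text \<open>
  The weights are positive, so the cumulative weights can serve as the abscissae of a diagram.
\<close>

lemma cum_sum_planar_diagram:
  assumes x: "bij_betw x {1..m} (X ` {1..n})" and \<pi>: "\<pi> permutes {1..m}"
  shows "planar_diagram m (cum_weight n X x \<pi>)"
proof
  have pos: "0 < value_weight n X (x (\<pi> k))" if "k \<in> {1..m}" for k
    using that bij_betw_apply[OF bij_betw_permuted[OF x \<pi>]] by (intro value_weight_pos) simp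
  have "cum_weight n X x \<pi> i < cum_weight n X x \<pi> j" if "i < j" "j \<le> m" for i j
    unfolding cum_weight_def
  proof (rule sum_strict_mono2[where b = j])
    show "0 < value_weight n X (x (\<pi> j))" using pos that by simp
    show "0 \<le> value_weight n X (x (\<pi> k))" if "k \<in> {1..j}" for k
      using pos[of k] that \<open>j \<le> m\<close> by simp
  qed (use that in auto)
  then show "strict_mono_on {..m} (cum_weight n X x \<pi>)"
    by (auto simp: strict_mono_on_def)
qed

lemma gcm_slope_eq_slope:
  assumes "planar_diagram m (cum_weight n X x \<pi>)"
  shows "gcm_slope n X Y m x \<pi> = planar_diagram.slope m (cum_weight n X x \<pi>) (cum_sum n X Y x \<pi>)"
proof -
  have "{..m} = insert 0 {1..m}" by auto
  then have "planar_diagram.diagram m (cum_weight n X x \<pi>) (cum_sum n X Y x \<pi>) = cum_sum_diagram n X Y m x \<pi>"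
    unfolding planar_diagram.diagram_def[OF assms] cum_sum_diagram_def
    by (simp add: cum_weight_def cum_sum_def)
  then show ?thesis by (simp add: gcm_slope_def fun_eq_iff)
qed

lemma gcm_slope_mono:
  assumes "bij_betw x {1..m} (X ` {1..n})" "\<pi> permutes {1..m}"
  shows "mono_on {1..m} (gcm_slope n X Y m x \<pi>)"
proof (rule mono_onI)
  note D = cum_sum_planar_diagram[OF assms]
  fix k l assume "k \<in> {1..m}" "l \<in> {1..m}" "k \<le> l"
  then show "gcm_slope n X Y m x \<pi> k \<le> gcm_slope n X Y m x \<pi> l"
    unfolding gcm_slope_eq_slope[OF D]
    using planar_diagram.slope_mono[OF D, of k l "cum_sum n X Y x \<pi>"] by simp
qed

lemma permutation_crit_le:
  assumes x: "bij_betw x {1..m} (X ` {1..n})" and \<pi>: "\<pi> permutes {1..m}"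
    and z: "mono_on {1..m} z"
  shows "permutation_crit n X Y m x \<pi> \<le>
    (\<Sum>k=1..m. value_weight n X (x (\<pi> k)) * (value_mean n X Y (x (\<pi> k)) - z k)\<^sup>2)"
proof -
  note D = cum_sum_planar_diagram[OF x \<pi>]
  have last: "sum f {1..k} - sum f {1..k - 1} = f k" if "k \<in> {1..m}" for f :: "nat \<Rightarrow> real" and k
    using that by (cases k) auto
  show ?thesis
    unfolding permutation_crit_def gcm_slope_eq_slope[OF D]
  proof (rule planar_diagram.slope_least_squares[OF D _ _ z])
    fix k assume k: "k \<in> {1..m}"
    show "value_weight n X (x (\<pi> k)) = cum_weight n X x \<pi> k - cum_weight n X x \<pi> (k - 1)"
      unfolding cum_weight_def by (rule last[OF k, symmetric])
    show "value_weight n X (x (\<pi> k)) * value_mean n X Y (x (\<pi> k)) =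
        cum_sum n X Y x \<pi> k - cum_sum n X Y x \<pi> (k - 1)"
      unfolding cum_sum_def by (rule last[OF k, symmetric])
  qed
qed

text \<open>
  Within a group the residuals from the group mean sum to zero, so the cross term of the expansion
  vanishes. The first sum does not mention \<open>\<Psi>\<close>, \<open>\<alpha>\<close> or the enumeration \<open>x\<close>, so the lemma
  can be applied along different permutations and the results compared.
\<close>

lemma least_squares_crit_decompose:
  assumes x: "bij_betw x {1..m} (X ` {1..n})"
  shows "least_squares_crit n X Y \<Psi> \<alpha> =
    (\<Sum>i=1..n. (Y i - value_mean n X Y (X i))\<^sup>2) +
    (\<Sum>k=1..m. value_weight n X (x k) * (value_mean n X Y (x k) - \<Psi> (\<alpha> \<bullet> x k))\<^sup>2)"
proof -
  define I where "I v = {i \<in> {1..n}. X i = v}" for v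
  have weight: "value_weight n X v = (\<Sum>i\<in>I v. 1)" for v
    unfolding value_weight_def I_def by (subst sum.inter_filter) (simp_all only: of_bool_def finite_atLeastAtMost)
  have total: "(\<Sum>i\<in>I v. Y i) = value_weight n X v * value_mean n X Y v" if "v \<in> X ` {1..n}" for v
  proof -
    have "(\<Sum>i=1..n. Y i * of_bool (X i = v)) = (\<Sum>i\<in>I v. Y i)"
      unfolding I_def by (subst sum.inter_filter) (auto intro!: sum.cong simp: of_bool_def)
    then show ?thesis
      using value_weight_pos[OF that] by (simp add: value_mean_def)
  qed
  have group: "(\<Sum>i\<in>I v. (Y i - c)\<^sup>2) = (\<Sum>i\<in>I v. (Y i - value_mean n X Y v)\<^sup>2) +
      value_weight n X v * (value_mean n X Y v - c)\<^sup>2" if "v \<in> X ` {1..n}" for v c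
  proof -
    let ?\<mu> = "value_mean n X Y v"
    have "(\<Sum>i\<in>I v. (Y i - c)\<^sup>2) =
      (\<Sum>i\<in>I v. (Y i - ?\<mu>)\<^sup>2 + 2 * (?\<mu> - c) * (Y i - ?\<mu> * 1) + (?\<mu> - c)\<^sup>2 * 1)"
      by (rule sum.cong[OF refl]) (simp add: power2_eq_square algebra_simps)
    also have "\<dots> = (\<Sum>i\<in>I v. (Y i - ?\<mu>)\<^sup>2) +
        2 * (?\<mu> - c) * ((\<Sum>i\<in>I v. Y i) - ?\<mu> * (\<Sum>i\<in>I v. 1)) + (?\<mu> - c)\<^sup>2 * (\<Sum>i\<in>I v. 1)"
      by (simp only: sum.distrib sum_subtractf sum_distrib_left[symmetric])
    also have "\<dots> = (\<Sum>i\<in>I v. (Y i - ?\<mu>)\<^sup>2) + value_weight n X v * (?\<mu> - c)\<^sup>2"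
      unfolding weight[symmetric] total[OF that] by (simp add: algebra_simps)
    finally show ?thesis .
  qed
  have by_value: "(\<Sum>i=1..n. f i) = (\<Sum>k=1..m. \<Sum>i\<in>I (x k). f i)" for f :: "nat \<Rightarrow> real"
  proof -
    have "(\<Sum>i=1..n. f i) = (\<Sum>v\<in>X ` {1..n}. \<Sum>i\<in>I v. f i)"
      unfolding I_def by (rule sum.image_gen) (rule finite_atLeastAtMost)
    also have "\<dots> = (\<Sum>k=1..m. \<Sum>i\<in>I (x k). f i)"
      by (rule sum.reindex_bij_betw[OF x, symmetric])
    finally show ?thesis .
  qed
  have xk: "x k \<in> X ` {1..n}" if "k \<in> {1..m}" for k
    using bij_betw_apply[OF x that] .
  have "least_squares_crit n X Y \<Psi> \<alpha> = (\<Sum>k=1..m. \<Sum>i\<in>I (x k). (Y i - \<Psi> (\<alpha> \<bullet> x k))\<^sup>2)"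
    unfolding least_squares_crit_def by_value
  proof (intro sum.cong refl)
    fix k i assume "i \<in> I (x k)"
    then have "X i = x k" by (simp add: I_def)
    then show "(Y i - \<Psi> (\<alpha> \<bullet> X i))\<^sup>2 = (Y i - \<Psi> (\<alpha> \<bullet> x k))\<^sup>2" by (simp only:)
  qed
  also have "\<dots> = (\<Sum>k=1..m. (\<Sum>i\<in>I (x k). (Y i - value_mean n X Y (X i))\<^sup>2) +
      value_weight n X (x k) * (value_mean n X Y (x k) - \<Psi> (\<alpha> \<bullet> x k))\<^sup>2)"
  proof (rule sum.cong[OF refl])
    fix k assume k: "k \<in> {1..m}"
    have "(\<Sum>i\<in>I (x k). (Y i - value_mean n X Y (X i))\<^sup>2) =
        (\<Sum>i\<in>I (x k). (Y i - value_mean n X Y (x k))\<^sup>2)"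
      by (intro sum.cong) (auto simp: I_def)
    then show "(\<Sum>i\<in>I (x k). (Y i - \<Psi> (\<alpha> \<bullet> x k))\<^sup>2) =
      (\<Sum>i\<in>I (x k). (Y i - value_mean n X Y (X i))\<^sup>2) +
      value_weight n X (x k) * (value_mean n X Y (x k) - \<Psi> (\<alpha> \<bullet> x k))\<^sup>2"
      unfolding group[OF xk[OF k], of "\<Psi> (\<alpha> \<bullet> x k)"] by (simp only:)
  qed
  also have "\<dots> = (\<Sum>i=1..n. (Y i - value_mean n X Y (X i))\<^sup>2) +
    (\<Sum>k=1..m. value_weight n X (x k) * (value_mean n X Y (x k) - \<Psi> (\<alpha> \<bullet> x k))\<^sup>2)"
    by (simp only: sum.distrib by_value)
  finally show ?thesis .
qed

section \<open>Directions and the permutations they induce\<close>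

text \<open>
  The directions that respect all strict inequalities of \<open>\<alpha>\<close> form an open neighbourhood of \<open>\<alpha>\<close>,
  whereas those that fail to separate \<open>V\<close> lie in a finite union of hyperplanes, which has measure
  zero and so cannot cover the neighbourhood.
\<close>

lemma ex_refining_direction:
  fixes \<alpha> :: "'a::euclidean_space"
  assumes "\<alpha> \<in> sphere 0 1" "finite V"
  obtains \<beta> where "\<beta> \<in> sphere 0 1"
    "\<And>u v. u \<in> V \<Longrightarrow> v \<in> V \<Longrightarrow> u \<noteq> v \<Longrightarrow> \<beta> \<bullet> u \<noteq> \<beta> \<bullet> v"
    "\<And>u v. u \<in> V \<Longrightarrow> v \<in> V \<Longrightarrow> \<alpha> \<bullet> u < \<alpha> \<bullet> v \<Longrightarrow> \<beta> \<bullet> u < \<beta> \<bullet> v"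
proof -
  \<comment> \<open>Including \<open>\<alpha>\<close> among the differences forces \<open>\<beta> \<bullet> \<alpha> > 0\<close>, so \<open>\<beta>\<close> can be normalized.\<close>
  define D where "D = insert \<alpha> ((\<lambda>(u, v). v - u) ` (V \<times> V))"
  define U where "U = (\<Inter>d\<in>{d \<in> D. 0 < \<alpha> \<bullet> d}. {\<beta>. 0 < \<beta> \<bullet> d})"
  define H where "H = (\<Union>d\<in>D - {0}. {\<beta>. d \<bullet> \<beta> = 0})"
  have "finite D" using assms(2) by (simp add: D_def)
  then have "open U"
    unfolding U_def by (intro open_INT ballI open_Collect_less continuous_intros) auto
  moreover have "\<alpha> \<in> U" by (auto simp: U_def)
  moreover have "negligible H"
    unfolding H_def using \<open>finite D\<close> negligible_hyperplane
    by (intro negligible_Union) auto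
  ultimately obtain \<beta> where \<beta>: "\<beta> \<in> U" "\<beta> \<notin> H"
    using open_not_negligible negligible_subset by blast
  have "\<alpha> \<bullet> \<alpha> = 1" using assms(1) by (simp add: dot_square_norm)
  then have "0 < \<beta> \<bullet> \<alpha>" using \<beta>(1) by (auto simp: U_def D_def)
  then have norm: "0 < norm \<beta>" by auto
  show ?thesis
  proof
    show "\<beta> /\<^sub>R norm \<beta> \<in> sphere 0 1" using norm by simp
  next
    fix u v assume uv: "u \<in> V" "v \<in> V" "u \<noteq> v"
    then have "v - u \<in> D - {0}" by (auto simp: D_def)
    then have "(v - u) \<bullet> \<beta> \<noteq> 0" using \<beta>(2) by (auto simp: H_def)
    then show "(\<beta> /\<^sub>R norm \<beta>) \<bullet> u \<noteq> (\<beta> /\<^sub>R norm \<beta>) \<bullet> v"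
      using norm by (simp add: inner_diff_right inner_commute)
  next
    fix u v assume uv: "u \<in> V" "v \<in> V" "\<alpha> \<bullet> u < \<alpha> \<bullet> v"
    then have "v - u \<in> {d \<in> D. 0 < \<alpha> \<bullet> d}" by (auto simp: D_def inner_diff_right)
    then have "0 < \<beta> \<bullet> (v - u)" using \<beta>(1) by (auto simp: U_def)
    then show "(\<beta> /\<^sub>R norm \<beta>) \<bullet> u < (\<beta> /\<^sub>R norm \<beta>) \<bullet> v"
      using norm by (simp add: inner_diff_right)
  qed
qed

lemma ex_sorting_permutation:
  fixes f :: "nat \<Rightarrow> 'a::linorder"
  assumes "inj_on f {1..m}"
  obtains \<pi> where "\<pi> permutes {1..m}" "strict_mono_on {1..m} (\<lambda>k. f (\<pi> k))"
proof -
  define h where "h = (!) (sorted_list_of_set (f ` {1..m}))"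
  have length: "length (sorted_list_of_set (f ` {1..m})) = m"
    using card_image[OF assms] by simp
  have h: "bij_betw h {..<m} (f ` {1..m})"
    unfolding h_def using length by (intro bij_betw_nth) auto
  have h_mono: "h i < h j" if "i < j" "j < m" for i j
    unfolding h_def using that length
    by (intro sorted_wrt_nth_less[OF strict_sorted_list_of_set]) auto
  define \<pi> where "\<pi> k = (if k \<in> {1..m} then the_inv_into {1..m} f (h (k - 1)) else k)" for k
  have shift: "bij_betw (\<lambda>k. k - 1) {1..m} {..<m}"
    by (rule bij_betwI[where g = Suc]) auto
  have "bij_betw (the_inv_into {1..m} f \<circ> (h \<circ> (\<lambda>k. k - 1))) {1..m} {1..m}"
    using bij_betw_trans[OF shift h] assms
    by (intro bij_betw_trans[of _ _ "f ` {1..m}"] bij_betw_the_inv_into) (auto simp: bij_betw_def)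
  then have "bij_betw \<pi> {1..m} {1..m}"
    by (rule bij_betw_cong[THEN iffD1, rotated]) (auto simp: \<pi>_def)
  then have "\<pi> permutes {1..m}"
    by (rule bij_imp_permutes) (auto simp: \<pi>_def)
  moreover have "f (\<pi> k) = h (k - 1)" if "k \<in> {1..m}" for k
  proof -
    have "h (k - 1) \<in> f ` {1..m}" using h that by (auto simp: bij_betw_def)
    then show ?thesis using that f_the_inv_into_f[OF assms] by (simp add: \<pi>_def)
  qed
  then have "strict_mono_on {1..m} (\<lambda>k. f (\<pi> k))"
    using h_mono by (auto simp: strict_mono_on_def)
  ultimately show ?thesis using that by blast
qed

text \<open>
  This is what makes tied directions harmless: a function that is non-decreasing along \<open>\<alpha>\<close> is
  non-decreasing along the permutation found here, which is induced by a nearby direction.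
\<close>

lemma ex_refining_permutation:
  fixes x :: "nat \<Rightarrow> real ^ 'd"
  assumes \<alpha>: "\<alpha> \<in> sphere 0 1" and x: "inj_on x {1..m}"
  obtains \<pi> where "\<pi> \<in> induced_permutations m x" "mono_on {1..m} (\<lambda>k. \<alpha> \<bullet> x (\<pi> k))"
proof -
  obtain \<beta> where \<beta>: "\<beta> \<in> sphere 0 1"
    and sep: "\<And>u v. u \<in> x ` {1..m} \<Longrightarrow> v \<in> x ` {1..m} \<Longrightarrow> u \<noteq> v \<Longrightarrow> \<beta> \<bullet> u \<noteq> \<beta> \<bullet> v"
    and ref: "\<And>u v. u \<in> x ` {1..m} \<Longrightarrow> v \<in> x ` {1..m} \<Longrightarrow> \<alpha> \<bullet> u < \<alpha> \<bullet> v \<Longrightarrow> \<beta> \<bullet> u < \<beta> \<bullet> v"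
    using ex_refining_direction[OF \<alpha>, of "x ` {1..m}"] by auto
  have "inj_on (\<lambda>k. \<beta> \<bullet> x k) {1..m}"
    using sep x unfolding inj_on_def by blast
  then obtain \<pi> where \<pi>: "\<pi> permutes {1..m}" "strict_mono_on {1..m} (\<lambda>k. \<beta> \<bullet> x (\<pi> k))"
    using ex_sorting_permutation by blast
  have "\<pi> \<in> induced_permutations m x"
    using \<beta> \<pi> by (auto simp: induced_permutations_def linearly_induces_def)
  moreover have "mono_on {1..m} (\<lambda>k. \<alpha> \<bullet> x (\<pi> k))"
  proof (intro mono_onI)
    fix k l assume kl: "k \<in> {1..m}" "l \<in> {1..m}" "k \<le> l"
    then have "\<beta> \<bullet> x (\<pi> k) \<le> \<beta> \<bullet> x (\<pi> l)"
      using \<pi>(2) by (cases "k = l") (auto simp: strict_mono_on_def intro!: order.strict_implies_order)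
    moreover have "x (\<pi> k) \<in> x ` {1..m}" "x (\<pi> l) \<in> x ` {1..m}"
      using permutes_in_image[OF \<pi>(1)] kl by blast+
    ultimately show "\<alpha> \<bullet> x (\<pi> k) \<le> \<alpha> \<bullet> x (\<pi> l)"
      using ref[of "x (\<pi> l)" "x (\<pi> k)"] by force
  qed
  ultimately show ?thesis using that by blast
qed

lemma ex_monotone_interpolation:
  fixes p d :: "nat \<Rightarrow> real"
  assumes p: "strict_mono_on {1..m} p" and d: "mono_on {1..m} d"
  obtains \<Psi> where "mono \<Psi>" "\<And>k. k \<in> {1..m} \<Longrightarrow> \<Psi> (p k) = d k"
proof
  \<comment> \<open>A right-continuous step function; inserting \<open>d 1\<close> gives its value to the left of all the nodes.\<close>
  define \<Psi> where "\<Psi> t = Max (insert (d 1) (d ` {k \<in> {1..m}. p k \<le> t}))" for t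
  show "mono \<Psi>"
    unfolding \<Psi>_def by (intro monoI Max_mono insert_mono image_mono) auto
  fix k assume k: "k \<in> {1..m}"
  have "d l \<le> d k" if "l \<in> {1..m}" "p l \<le> p k" for l
  proof -
    have "l \<le> k"
      using that p k by (metis not_le strict_mono_on_def)
    then show ?thesis using d k that by (auto simp: mono_on_def)
  qed
  moreover have "d 1 \<le> d k" using d k by (auto simp: mono_on_def)
  ultimately show "\<Psi> (p k) = d k"
    unfolding \<Psi>_def using k by (intro Max_eqI) auto
qed

section \<open>Reduction to the induced permutations\<close>

text \<open>
  An arbitrary competitor \<open>(\<Phi>, \<beta>)\<close> is compared along a permutation that refines the order of
  \<open>\<beta>\<close>: its values there are monotone, so isotonic regression bounds its criterion below by that of
  the permutation, and optimality of \<open>\<pi>\<close> does the rest.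
\<close>

lemma is_minimizer_of_optimal_permutation:
  assumes x: "bij_betw x {1..m} (X ` {1..n})"
    and \<pi>: "linearly_induces m x \<alpha> \<pi>"
    and opt: "is_arg_min (permutation_crit n X Y m x) (\<lambda>\<sigma>. \<sigma> \<in> induced_permutations m x) \<pi>"
    and \<Psi>: "mono \<Psi>" "\<And>k. k \<in> {1..m} \<Longrightarrow> \<Psi> (\<alpha> \<bullet> x (\<pi> k)) = gcm_slope n X Y m x \<pi> k"
  shows "is_minimizer n X Y \<Psi> \<alpha>"
proof -
  let ?C = "\<Sum>i=1..n. (Y i - value_mean n X Y (X i))\<^sup>2"
  have perm: "\<pi> permutes {1..m}" and \<alpha>: "\<alpha> \<in> sphere 0 1"
    using \<pi> by (auto simp: linearly_induces_def)
  have attained: "least_squares_crit n X Y \<Psi> \<alpha> = ?C + permutation_crit n X Y m x \<pi>"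
    unfolding least_squares_crit_decompose[OF bij_betw_permuted[OF x perm]] permutation_crit_def
    by (simp add: \<Psi>(2))
  have "least_squares_crit n X Y \<Psi> \<alpha> \<le> least_squares_crit n X Y \<Phi> \<beta>"
    if \<Phi>: "mono \<Phi>" and \<beta>: "\<beta> \<in> sphere 0 1" for \<Phi> \<beta>
  proof -
    obtain \<sigma> where \<sigma>: "\<sigma> \<in> induced_permutations m x" "mono_on {1..m} (\<lambda>k. \<beta> \<bullet> x (\<sigma> k))"
      using ex_refining_permutation[OF \<beta> bij_betw_imp_inj_on[OF x]] .
    then have perm': "\<sigma> permutes {1..m}"
      by (auto simp: induced_permutations_def linearly_induces_def)
    have "permutation_crit n X Y m x \<pi> \<le> permutation_crit n X Y m x \<sigma>"
      using opt \<sigma>(1) by (auto simp: is_arg_min_def not_less)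
    also have "\<dots> \<le> (\<Sum>k=1..m. value_weight n X (x (\<sigma> k)) *
        (value_mean n X Y (x (\<sigma> k)) - \<Phi> (\<beta> \<bullet> x (\<sigma> k)))\<^sup>2)"
      using \<sigma>(2) \<Phi>
      by (intro permutation_crit_le[OF x perm', where z = "\<lambda>k. \<Phi> (\<beta> \<bullet> x (\<sigma> k))"])
        (auto simp: mono_on_def mono_def)
    finally show ?thesis
      unfolding attained
      unfolding least_squares_crit_decompose[OF bij_betw_permuted[OF x perm']]
      by (rule add_left_mono)
  qed
  then show ?thesis
    using \<Psi>(1) \<alpha> by (auto simp: is_minimizer_def is_arg_min_def not_less)
qed

theorem theorem2p3:
  fixes n m :: nat
    and X x :: "nat \<Rightarrow> real ^ 'd"
    and Y :: "nat \<Rightarrow> real"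
  assumes "n \<ge> 1"
    and "bij_betw x {1..m} (X ` {1..n})"
  shows "(\<exists>\<Psi> \<alpha>. is_minimizer n X Y \<Psi> \<alpha>) \<and>
    (\<forall>\<Psi> \<alpha> \<pi>.
      \<alpha> \<in> separating_directions n X \<and>
      linearly_induces m x \<alpha> \<pi> \<and>
      is_arg_min (permutation_crit n X Y m x) (\<lambda>\<sigma>. \<sigma> \<in> induced_permutations m x) \<pi> \<and>
      mono \<Psi> \<and>
      (\<forall>k\<in>{1..m}. \<Psi> (\<alpha> \<bullet> x (\<pi> k)) = gcm_slope n X Y m x \<pi> k)
      \<longrightarrow> is_minimizer n X Y \<Psi> \<alpha>)"
proof
  obtain e :: "real ^ 'd" where "norm e = 1"
    using vector_choose_size[OF zero_le_one] .
  then have e: "e \<in> sphere 0 1" by simp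
  obtain \<sigma> where "\<sigma> \<in> induced_permutations m x" "mono_on {1..m} (\<lambda>k. e \<bullet> x (\<sigma> k))"
    using ex_refining_permutation[OF e bij_betw_imp_inj_on[OF assms(2)]] .
  then have "induced_permutations m x \<noteq> {}" by auto
  moreover have "finite (induced_permutations m x)"
    by (rule finite_subset[OF _ finite_permutations[of "{1..m}"]])
      (auto simp: induced_permutations_def linearly_induces_def)
  ultimately obtain \<pi> where
    opt: "is_arg_min (permutation_crit n X Y m x) (\<lambda>\<sigma>. \<sigma> \<in> induced_permutations m x) \<pi>"
    using ex_is_arg_min_if_finite[of "induced_permutations m x"] by metis
  then obtain \<alpha> where \<alpha>: "linearly_induces m x \<alpha> \<pi>"
    unfolding is_arg_min_def induced_permutations_def by blast
  then have \<pi>: "\<pi> permutes {1..m}" "strict_mono_on {1..m} (\<lambda>k. \<alpha> \<bullet> x (\<pi> k))"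
    by (simp_all add: linearly_induces_def)
  obtain \<Psi> where "mono \<Psi>" "\<And>k. k \<in> {1..m} \<Longrightarrow> \<Psi> (\<alpha> \<bullet> x (\<pi> k)) = gcm_slope n X Y m x \<pi> k"
    using ex_monotone_interpolation[OF \<pi>(2) gcm_slope_mono[OF assms(2) \<pi>(1), of Y]] by blast
  then have "is_minimizer n X Y \<Psi> \<alpha>"
    by (rule is_minimizer_of_optimal_permutation[OF assms(2) \<alpha> opt])
  then show "\<exists>\<Psi> \<alpha>. is_minimizer n X Y \<Psi> \<alpha>"
    by (intro exI)
qed (intro allI impI, elim conjE, rule is_minimizer_of_optimal_permutation[OF assms(2)], assumption+, erule bspec)

end
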